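(* Let $(H;\langle\cdot,\cdot\rangle)$ be an inner product space over the real or complex number field $\mathbb{K}$, let $y_i\in H$ for $i\in\{1,\dots,n\}$, and let $M\ge m>0$ be such that either $$\operatorname{Re}\langle My_j-y_i,\,y_i-my_j\rangle\ge0\qquad\text{for }1\le i<j\le n,$$ or, equivalently, $$\Big\|y_i-\frac{M+m}{2}y_j\Big\|\le\frac12(M-m)\|y_j\|\qquad\text{for }1\le i<j\le n.$$ Then $$\Big(\sum_{i=1}^n\|y_i\|\Big)^2\le\Big\|\sum_{i=1}^n y_i\Big\|^2+\frac12\cdot\frac{(M-m)^2}{M+m}\sum_{k=1}^{n-1}k\|y_{k+1}\|^2.$$ Equality holds in this last inequality if and only if $$\|y_i\|\,\|y_j\|-\operatorname{Re}\langle y_i,y_j\rangle=\frac14\cdot\frac{(M-m)^2}{M+m}\|y_j\|^2$$ for each $i,j$ with $1\le i<j\le n$.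
   Context: $n$ is a positive integer and $\|\cdot\|$ is the norm induced by the inner product. *)

theory Defs
  imports Complex_Main "HOL-Analysis.Inner_Product"
begin

text \<open>
  The scalar fields: a type of this class is, via \<open>to_complex\<close>, a copy of the real or of
  the complex numbers. Real parts and conjugates of scalars are taken in the complex numbers.
\<close>

class real_or_complex = real_field +
  fixes to_complex :: "'a \<Rightarrow> complex"
  assumes to_complex_add: "to_complex (a + b) = to_complex a + to_complex b"
    and to_complex_mult: "to_complex (a * b) = to_complex a * to_complex b"
    and to_complex_one: "to_complex 1 = 1"
    and to_complex_scaleR: "to_complex (r *\<^sub>R a) = r *\<^sub>R to_complex a"
    and range_to_complex: "range to_complex = \<real> \<or> range to_complex = UNIV"

instantiation real :: real_or_complex
begin
definition to_complex_real :: "real \<Rightarrow> complex" where "to_complex_real = complex_of_real"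
instance
  by standard (simp_all add: to_complex_real_def Reals_def scaleR_conv_of_real)
end

instantiation complex :: real_or_complex
begin
definition to_complex_complex :: "complex \<Rightarrow> complex" where "to_complex_complex = id"
instance
  by standard (simp_all add: to_complex_complex_def)
end

definition scalar_Re :: "'k::real_or_complex \<Rightarrow> real"
  where "scalar_Re a = Re (to_complex a)"

lemma scalar_Re_real [simp]: "scalar_Re (x :: real) = x"
  by (simp add: scalar_Re_def to_complex_real_def)

lemma scalar_Re_complex [simp]: "scalar_Re (z :: complex) = Re z"
  by (simp add: scalar_Re_def to_complex_complex_def)

text \<open>
  The inner product is linear in the first argument. By conjugate symmetry \<open>ip x x\<close> is real,
  so its sign is that of its real part.
\<close>

locale inner_product_space = vector_space scale
  for scale :: "'k::real_or_complex \<Rightarrow> 'h::ab_group_add \<Rightarrow> 'h" +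
  fixes ip :: "'h \<Rightarrow> 'h \<Rightarrow> 'k"
  assumes ip_add_left: "ip (x + y) z = ip x z + ip y z"
    and ip_scale_left: "ip (scale a x) z = a * ip x z"
    and ip_commute: "to_complex (ip y x) = cnj (to_complex (ip x y))"
    and ip_nonneg: "0 \<le> scalar_Re (ip x x)"
    and ip_eq_zero_iff: "ip x x = 0 \<longleftrightarrow> x = 0"

definition ip_norm :: "('h \<Rightarrow> 'h \<Rightarrow> 'k::real_or_complex) \<Rightarrow> 'h \<Rightarrow> real"
  where "ip_norm ip x = sqrt (scalar_Re (ip x x))"

lemma inner_product_space_real_inner:
  "inner_product_space scaleR (inner :: 'a::real_inner \<Rightarrow> 'a \<Rightarrow> real)"
  by unfold_locales
    (simp_all add: to_complex_real_def inner_commute algebra_simps)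

lemma ip_norm_inner: "ip_norm inner x = norm (x :: 'a::real_inner)"
  by (simp add: ip_norm_def norm_eq_sqrt_inner)

lemma inner_product_space_complex: "inner_product_space (*) (\<lambda>z w :: complex. z * cnj w)"
  by unfold_locales (simp_all add: to_complex_complex_def algebra_simps)

end

theory Submission
  imports Defs
begin

text \<open>
  The argument rests on one pair of vectors. Write \<open>\<rho> = Re \<langle>x, w\<rangle>\<close>. Both forms of the
  hypothesis expand to the same inequality
  \<open>\<parallel>x\<parallel>\<^sup>2 + m M \<parallel>w\<parallel>\<^sup>2 \<le> (M + m) \<rho>\<close>, so they are equivalent for each pair separately, and
  completing the square in \<open>\<parallel>x\<parallel>\<close> turns it into a reverse Cauchy--Schwarz inequality
  \<open>\<parallel>x\<parallel> \<parallel>w\<parallel> - \<rho> \<le> (M - m)\<^sup>2 / (4 (M + m)) \<parallel>w\<parallel>\<^sup>2\<close>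
  (lemma \<open>reverse_Cauchy_Schwarz\<close>).

  Expanding both squares shows that \<open>(\<Sum> \<parallel>y i\<parallel>)\<^sup>2 - \<parallel>\<Sum> y i\<parallel>\<^sup>2\<close> is twice the sum over
  the pairs \<open>i < j\<close> of the defects \<open>\<parallel>y i\<parallel> \<parallel>y j\<parallel> - Re \<langle>y i, y j\<rangle>\<close>, because the defect is
  symmetric and vanishes on the diagonal (lemma \<open>square_sum_norms_minus_square_norm_sum\<close>).
  Bounding every defect and counting that each \<open>j\<close> has \<open>j - 1\<close> predecessors gives the weights
  \<open>k\<close> on \<open>\<parallel>y (k + 1)\<parallel>\<^sup>2\<close>. Since the estimate is made term by term in a finite sum, equality
  of the sums forces equality in every term.
\<close>

lemma scalar_Re_add: "scalar_Re (a + b) = scalar_Re a + scalar_Re b"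
  by (simp add: scalar_Re_def to_complex_add)

lemma scalar_Re_of_real_mult: "scalar_Re (of_real c * a) = c * scalar_Re a"
  by (simp add: scalar_Re_def of_real_def to_complex_scaleR)

text \<open>
  Only real parts enter the estimates: they make \<open>H\<close> a space with a symmetric form that is
  bilinear over the reals, whichever of the two scalar fields is used.
\<close>

context inner_product_space
begin

abbreviation Re_ip :: "'h \<Rightarrow> 'h \<Rightarrow> real"
  where "Re_ip x y \<equiv> scalar_Re (ip x y)"

lemma Re_ip_commute: "Re_ip x y = Re_ip y x"
  using ip_commute[of x y] by (simp add: scalar_Re_def)

lemma Re_ip_add_left: "Re_ip (x + y) z = Re_ip x z + Re_ip y z"
  by (simp add: ip_add_left scalar_Re_add)

lemma Re_ip_diff_left: "Re_ip (x - y) z = Re_ip x z - Re_ip y z"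
  using Re_ip_add_left[of "x - y" y z] by simp

lemma Re_ip_diff_right: "Re_ip z (x - y) = Re_ip z x - Re_ip z y"
  by (metis Re_ip_commute Re_ip_diff_left)

lemma Re_ip_scale_left: "Re_ip (scale (of_real c) x) z = c * Re_ip x z"
  by (simp add: ip_scale_left scalar_Re_of_real_mult)

lemma Re_ip_scale_right: "Re_ip z (scale (of_real c) x) = c * Re_ip z x"
  by (metis Re_ip_commute Re_ip_scale_left)

lemma Re_ip_zero_left: "Re_ip 0 z = 0"
  using Re_ip_diff_left[of 0 0 z] by simp

lemma Re_ip_sum_left: "Re_ip (\<Sum>i\<in>A. f i) z = (\<Sum>i\<in>A. Re_ip (f i) z)"
  by (induction A rule: infinite_finite_induct) (simp_all add: Re_ip_zero_left Re_ip_add_left)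

lemma Re_ip_sum_right: "Re_ip z (\<Sum>i\<in>A. f i) = (\<Sum>i\<in>A. Re_ip z (f i))"
  by (simp add: Re_ip_commute[of z] Re_ip_sum_left)

lemma ip_norm_nonneg: "0 \<le> ip_norm ip x"
  by (simp add: ip_norm_def ip_nonneg)

lemma ip_norm_square: "(ip_norm ip x)\<^sup>2 = Re_ip x x"
  by (simp add: ip_norm_def ip_nonneg)

lemma Re_ip_between_iff:
  "0 \<le> Re_ip (scale (of_real M) w - x) (x - scale (of_real m) w) \<longleftrightarrow>
   (ip_norm ip x)\<^sup>2 + m * M * (ip_norm ip w)\<^sup>2 \<le> (M + m) * Re_ip x w"
  by (simp add: Re_ip_diff_left Re_ip_diff_right Re_ip_scale_left Re_ip_scale_right
      ip_norm_square Re_ip_commute[of w x] algebra_simps)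

text \<open>
  Geometrically this is Thales' theorem: \<open>m w\<close> and \<open>M w\<close> are the ends of a diameter of the
  ball about \<open>(M + m) / 2 * w\<close>, so \<open>x\<close> lies in the ball exactly when it sees the diameter at
  an angle of at least ninety degrees or is one of its ends, which is the condition of lemma
  \<open>Re_ip_between_iff\<close>. The common right-hand side is the form that the estimate uses.
\<close>

lemma ip_norm_midpoint_iff:
  assumes "m \<le> M"
  shows "ip_norm ip (x - scale (of_real ((M + m) / 2)) w) \<le> 1 / 2 * (M - m) * ip_norm ip w \<longleftrightarrow>
   (ip_norm ip x)\<^sup>2 + m * M * (ip_norm ip w)\<^sup>2 \<le> (M + m) * Re_ip x w"
proof -
  define c where "c = (M + m) / 2"
  define r where "r = 1 / 2 * (M - m)"
  have r: "0 \<le> r * ip_norm ip w"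
    using assms by (simp add: r_def ip_norm_nonneg)
  have "ip_norm ip (x - scale (of_real c) w) \<le> r * ip_norm ip w \<longleftrightarrow>
        (ip_norm ip (x - scale (of_real c) w))\<^sup>2 \<le> (r * ip_norm ip w)\<^sup>2"
    using r by (simp add: ip_norm_nonneg power_mono_iff)
  also have "(ip_norm ip (x - scale (of_real c) w))\<^sup>2
      = (ip_norm ip x)\<^sup>2 - 2 * c * Re_ip x w + c\<^sup>2 * (ip_norm ip w)\<^sup>2"
    unfolding ip_norm_square
    by (simp add: Re_ip_diff_left Re_ip_diff_right Re_ip_scale_left
        Re_ip_scale_right Re_ip_commute[of w x] algebra_simps power2_eq_square)
  also have "(r * ip_norm ip w)\<^sup>2 = c\<^sup>2 * (ip_norm ip w)\<^sup>2 - m * M * (ip_norm ip w)\<^sup>2"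
    by (simp add: r_def c_def field_simps power2_eq_square)
  finally have "ip_norm ip (x - scale (of_real c) w) \<le> r * ip_norm ip w \<longleftrightarrow>
      (ip_norm ip x)\<^sup>2 + m * M * (ip_norm ip w)\<^sup>2 \<le> 2 * c * Re_ip x w"
    by linarith
  moreover have "2 * c = M + m"
    by (simp add: c_def)
  ultimately show ?thesis
    unfolding c_def r_def by metis
qed

text \<open>
  The square completed here is \<open>(\<parallel>x\<parallel> - (M + m) / 2 * \<parallel>w\<parallel>)\<^sup>2\<close>; it is what the estimate drops.
\<close>

lemma reverse_Cauchy_Schwarz:
  assumes "0 < M + m"
    and "(ip_norm ip x)\<^sup>2 + m * M * (ip_norm ip w)\<^sup>2 \<le> (M + m) * Re_ip x w"
  shows "ip_norm ip x * ip_norm ip w - Re_ip x w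
      \<le> 1 / 4 * ((M - m)\<^sup>2 / (M + m)) * (ip_norm ip w)\<^sup>2"
proof -
  have "(M + m) * (ip_norm ip x * ip_norm ip w - Re_ip x w)
      \<le> (M + m) * (ip_norm ip x * ip_norm ip w) - (ip_norm ip x)\<^sup>2 - m * M * (ip_norm ip w)\<^sup>2"
    using assms(2) by (simp add: algebra_simps)
  also have "\<dots> = 1 / 4 * (M - m)\<^sup>2 * (ip_norm ip w)\<^sup>2
      - (ip_norm ip x - (M + m) / 2 * ip_norm ip w)\<^sup>2"
    by (simp add: field_simps power2_eq_square)
  also have "\<dots> \<le> 1 / 4 * (M - m)\<^sup>2 * (ip_norm ip w)\<^sup>2"
    by simp
  finally show ?thesis
    using assms(1) by (simp add: field_simps)
qed

end

text \<open>The square \<open>{1..n} \<times> {1..n}\<close> is the diagonal together with two mirror-image triangles.\<close>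

lemma sum_square_symmetric:
  fixes d :: "nat \<Rightarrow> nat \<Rightarrow> real"
  assumes "\<And>i j. d i j = d j i" and "\<And>i. d i i = 0"
  shows "(\<Sum>i = 1..n. \<Sum>j = 1..n. d i j) = 2 * (\<Sum>j = 1..n. \<Sum>i = 1..<j. d i j)"
proof (induction n)
  case (Suc n)
  have "(\<Sum>i = 1..Suc n. \<Sum>j = 1..Suc n. d i j)
      = (\<Sum>i = 1..n. \<Sum>j = 1..n. d i j)
        + (\<Sum>i = 1..n. d i (Suc n)) + (\<Sum>j = 1..n. d (Suc n) j)"
    by (simp add: sum.distrib assms(2))
  also have "(\<Sum>j = 1..n. d (Suc n) j) = (\<Sum>i = 1..n. d i (Suc n))"
    by (simp add: assms(1)[of "Suc n"])
  finally show ?case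
    using Suc.IH by (simp add: atLeastLessThanSuc_atLeastAtMost)
qed simp

lemma (in inner_product_space) square_sum_norms_minus_square_norm_sum:
  fixes y :: "nat \<Rightarrow> 'h"
  shows "(\<Sum>i = 1..n. ip_norm ip (y i))\<^sup>2 - (ip_norm ip (\<Sum>i = 1..n. y i))\<^sup>2
   = 2 * (\<Sum>j = 1..n. \<Sum>i = 1..<j. ip_norm ip (y i) * ip_norm ip (y j) - Re_ip (y i) (y j))"
proof -
  have "(\<Sum>i = 1..n. ip_norm ip (y i))\<^sup>2 - (ip_norm ip (\<Sum>i = 1..n. y i))\<^sup>2
      = (\<Sum>i = 1..n. \<Sum>j = 1..n. ip_norm ip (y i) * ip_norm ip (y j) - Re_ip (y i) (y j))"
    unfolding ip_norm_square Re_ip_sum_left Re_ip_sum_right power2_eq_square[of "sum _ _"]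
      sum_product sum_subtractf
    by (simp add: Re_ip_commute)
  also have "\<dots>
      = 2 * (\<Sum>j = 1..n. \<Sum>i = 1..<j. ip_norm ip (y i) * ip_norm ip (y j) - Re_ip (y i) (y j))"
    by (rule sum_square_symmetric
        [of "\<lambda>i j. ip_norm ip (y i) * ip_norm ip (y j) - Re_ip (y i) (y j)"])
      (simp_all add: Re_ip_commute mult.commute flip: ip_norm_square power2_eq_square)
  finally show ?thesis .
qed

lemma sum_weighted_eq_sum_triangle:
  fixes f :: "nat \<Rightarrow> real"
  shows "(\<Sum>k = 1..n - 1. real k * f (k + 1)) = (\<Sum>j = 1..n. \<Sum>i = 1..<j. f j)"
proof (induction n)
  case (Suc n)
  then show ?case by (cases n) simp_all
qed simp

text \<open>
  Inequality and equality case together: the slack of the whole sum is the sum of the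
  nonnegative slacks of its terms, so it vanishes only if each of them does.
\<close>

lemma sum_triangle_mono_eq_iff:
  fixes d e :: "nat \<Rightarrow> nat \<Rightarrow> real"
  assumes "\<And>i j. 1 \<le> i \<Longrightarrow> i < j \<Longrightarrow> j \<le> n \<Longrightarrow> d i j \<le> e i j"
  shows "(\<Sum>j = 1..n. \<Sum>i = 1..<j. d i j) \<le> (\<Sum>j = 1..n. \<Sum>i = 1..<j. e i j)"
    and "(\<Sum>j = 1..n. \<Sum>i = 1..<j. d i j) = (\<Sum>j = 1..n. \<Sum>i = 1..<j. e i j) \<longleftrightarrow>
      (\<forall>i j. 1 \<le> i \<and> i < j \<and> j \<le> n \<longrightarrow> d i j = e i j)"
proof -
  show "(\<Sum>j = 1..n. \<Sum>i = 1..<j. d i j) \<le> (\<Sum>j = 1..n. \<Sum>i = 1..<j. e i j)"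
    by (intro sum_mono) (simp add: assms)
  have "(\<Sum>j = 1..n. \<Sum>i = 1..<j. d i j) = (\<Sum>j = 1..n. \<Sum>i = 1..<j. e i j) \<longleftrightarrow>
      (\<Sum>j = 1..n. \<Sum>i = 1..<j. e i j - d i j) = 0"
    by (auto simp: sum_subtractf)
  also have "\<dots> \<longleftrightarrow> (\<forall>j\<in>{1..n}. (\<Sum>i = 1..<j. e i j - d i j) = 0)"
    by (rule sum_nonneg_eq_0_iff) (auto intro!: sum_nonneg simp: assms)
  also have "\<dots> \<longleftrightarrow> (\<forall>j\<in>{1..n}. \<forall>i\<in>{1..<j}. e i j - d i j = 0)"
    by (intro ball_cong refl sum_nonneg_eq_0_iff) (auto simp: assms)
  also have "\<dots> \<longleftrightarrow> (\<forall>i j. 1 \<le> i \<and> i < j \<and> j \<le> n \<longrightarrow> d i j = e i j)"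
    by fastforce
  finally show "(\<Sum>j = 1..n. \<Sum>i = 1..<j. d i j) = (\<Sum>j = 1..n. \<Sum>i = 1..<j. e i j) \<longleftrightarrow>
      (\<forall>i j. 1 \<le> i \<and> i < j \<and> j \<le> n \<longrightarrow> d i j = e i j)" .
qed

theorem theorem5:
  fixes scale :: "'k::real_or_complex \<Rightarrow> 'h::ab_group_add \<Rightarrow> 'h"
    and ip :: "'h \<Rightarrow> 'h \<Rightarrow> 'k"
    and y :: "nat \<Rightarrow> 'h"
    and n :: nat
    and m M :: real
  assumes "inner_product_space scale ip"
    and "1 \<le> n"
    and "0 < m" and "m \<le> M"
  shows
    "((\<forall>i j. 1 \<le> i \<and> i < j \<and> j \<le> n \<longrightarrow>
         0 \<le> scalar_Re (ip (scale (of_real M) (y j) - y i) (y i - scale (of_real m) (y j))))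
      \<longleftrightarrow>
      (\<forall>i j. 1 \<le> i \<and> i < j \<and> j \<le> n \<longrightarrow>
         ip_norm ip (y i - scale (of_real ((M + m) / 2)) (y j)) \<le> 1 / 2 * (M - m) * ip_norm ip (y j)))
     \<and>
     ((\<forall>i j. 1 \<le> i \<and> i < j \<and> j \<le> n \<longrightarrow>
         0 \<le> scalar_Re (ip (scale (of_real M) (y j) - y i) (y i - scale (of_real m) (y j))))
      \<or>
      (\<forall>i j. 1 \<le> i \<and> i < j \<and> j \<le> n \<longrightarrow>
         ip_norm ip (y i - scale (of_real ((M + m) / 2)) (y j)) \<le> 1 / 2 * (M - m) * ip_norm ip (y j))
      \<longrightarrow>
      (\<Sum>i = 1..n. ip_norm ip (y i))\<^sup>2
        \<le> (ip_norm ip (\<Sum>i = 1..n. y i))\<^sup>2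
          + 1 / 2 * ((M - m)\<^sup>2 / (M + m)) * (\<Sum>k = 1..n - 1. real k * (ip_norm ip (y (k + 1)))\<^sup>2)
      \<and>
      ((\<Sum>i = 1..n. ip_norm ip (y i))\<^sup>2
        = (ip_norm ip (\<Sum>i = 1..n. y i))\<^sup>2
          + 1 / 2 * ((M - m)\<^sup>2 / (M + m)) * (\<Sum>k = 1..n - 1. real k * (ip_norm ip (y (k + 1)))\<^sup>2)
       \<longleftrightarrow>
       (\<forall>i j. 1 \<le> i \<and> i < j \<and> j \<le> n \<longrightarrow>
          ip_norm ip (y i) * ip_norm ip (y j) - scalar_Re (ip (y i) (y j))
            = 1 / 4 * ((M - m)\<^sup>2 / (M + m)) * (ip_norm ip (y j))\<^sup>2)))"
proof -
  interpret inner_product_space scale ip by fact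
  define d where "d i j = ip_norm ip (y i) * ip_norm ip (y j) - scalar_Re (ip (y i) (y j))" for i j
  define C where "C = 1 / 4 * ((M - m)\<^sup>2 / (M + m))"
  let ?P = "\<forall>i j. 1 \<le> i \<and> i < j \<and> j \<le> n \<longrightarrow>
      (ip_norm ip (y i))\<^sup>2 + m * M * (ip_norm ip (y j))\<^sup>2 \<le> (M + m) * scalar_Re (ip (y i) (y j))"
  let ?L = "(\<Sum>i = 1..n. ip_norm ip (y i))\<^sup>2"
  let ?N = "(ip_norm ip (\<Sum>i = 1..n. y i))\<^sup>2"
  let ?R = "1 / 2 * ((M - m)\<^sup>2 / (M + m)) * (\<Sum>k = 1..n - 1. real k * (ip_norm ip (y (k + 1)))\<^sup>2)"
  have defects: "?L - ?N = 2 * (\<Sum>j = 1..n. \<Sum>i = 1..<j. d i j)"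
    unfolding d_def by (rule square_sum_norms_minus_square_norm_sum)
  have double: "1 / 2 * ((M - m)\<^sup>2 / (M + m)) = 2 * C"
    unfolding C_def by linarith
  have bounds: "?R = 2 * (\<Sum>j = 1..n. \<Sum>i = 1..<j. C * (ip_norm ip (y j))\<^sup>2)"
    unfolding sum_weighted_eq_sum_triangle[of "\<lambda>j. (ip_norm ip (y j))\<^sup>2"] sum_distrib_left[symmetric]
      double by (simp only: mult.assoc)
  have main: "?L \<le> ?N + ?R \<and> (?L = ?N + ?R \<longleftrightarrow>
      (\<forall>i j. 1 \<le> i \<and> i < j \<and> j \<le> n \<longrightarrow> d i j = C * (ip_norm ip (y j))\<^sup>2))" if ?P
  proof -
    have le: "d i j \<le> C * (ip_norm ip (y j))\<^sup>2" if "1 \<le> i" "i < j" "j \<le> n" for i j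
      unfolding d_def C_def using that assms(3,4) \<open>?P\<close>
      by (intro reverse_Cauchy_Schwarz) auto
    note triangle = sum_triangle_mono_eq_iff[of n d "\<lambda>i j. C * (ip_norm ip (y j))\<^sup>2", OF le]
    have "?L \<le> ?N + ?R"
      using defects bounds triangle(1) by linarith
    moreover have "?L = ?N + ?R \<longleftrightarrow> (\<Sum>j = 1..n. \<Sum>i = 1..<j. d i j)
        = (\<Sum>j = 1..n. \<Sum>i = 1..<j. C * (ip_norm ip (y j))\<^sup>2)"
      using defects bounds by linarith
    ultimately show ?thesis
      using triangle(2) by simp
  qed
  show ?thesis
    unfolding Re_ip_between_iff ip_norm_midpoint_iff[OF assms(4)]
    using main unfolding d_def C_def by blast
qed

end
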